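(* Let $\mathcal H$ be a Hilbert space, $p\ge1$, and let $\mathcal J:\mathcal H\to\mathbb R\cup\{+\infty\}$ be absolutely $p$-homogeneous, convex, proper and lower semicontinuous. Consider the minimisation problem $$\lambda_1:=\inf_{v\in\mathcal N_{\mathcal J}^\perp\setminus\{0\}}\frac{p\,\mathcal J(v)}{\|v\|^p}.$$ Then $u\in\mathcal N_{\mathcal J}^\perp\setminus\{0\}$ is a minimiser of this problem if and only if it satisfies $$\lambda_1\|u\|^{p-2}u\in\partial\mathcal J(u),$$ in which case $\lambda_1=\frac{p\,\mathcal J(u)}{\|u\|^p}$.
   Context: $\mathcal J$ is absolutely $p$-homogeneous if $\mathcal J(0)=0$ and $\mathcal J(cu)=|c|^p\mathcal J(u)$ for all $u\in\mathcal H$ and $c\ne0$. The null space $\mathcal N_{\mathcal J}=\{u\in\mathcal H:\mathcal J(u)=0\}$ is a closed linear subspace and $\mathcal N_{\mathcal J}^\perp$ is its orthogonal complement. $\partial\mathcal J(u)=\{\zeta\in\mathcal H:\mathcal J(v)\ge\mathcal J(u)+\langle\zeta,v-u\rangle\ \forall v\in\mathcal H\}$. *)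

theory Defs
  imports "HOL-Analysis.Analysis"
begin

text \<open>
  Functionals with values in \<open>\<real> \<union> {+\<infinity>}\<close> are functions into \<^typ>\<open>ereal\<close> that
  never take the value \<open>-\<infinity>\<close>; this is part of properness. Hilbert spaces are real.
\<close>

definition proper_functional :: "('a \<Rightarrow> ereal) \<Rightarrow> bool" where
  "proper_functional J \<longleftrightarrow> (\<forall>x. J x \<noteq> -\<infinity>) \<and> (\<exists>x. J x \<noteq> \<infinity>)"

text \<open>
  The library notion of convexity on a set is restricted to real-valued functions.
  In \<^typ>\<open>ereal\<close> we have \<open>0 * \<infinity> = 0\<close>, so the cases \<open>s = 0\<close> and \<open>t = 0\<close> impose nothing.
\<close>

definition convex_functional :: "('a::real_vector \<Rightarrow> ereal) \<Rightarrow> bool" where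
  "convex_functional J \<longleftrightarrow>
     (\<forall>x y. \<forall>s\<ge>0. \<forall>t\<ge>0. s + t = 1 \<longrightarrow>
        J (s *\<^sub>R x + t *\<^sub>R y) \<le> ereal s * J x + ereal t * J y)"

definition lower_semicontinuous :: "('a::topological_space \<Rightarrow> ereal) \<Rightarrow> bool" where
  "lower_semicontinuous J \<longleftrightarrow> (\<forall>x. J x \<le> Liminf (at x) J)"

definition absolutely_homogeneous :: "real \<Rightarrow> ('a::real_vector \<Rightarrow> ereal) \<Rightarrow> bool" where
  "absolutely_homogeneous p J \<longleftrightarrow>
     J 0 = 0 \<and> (\<forall>u c. c \<noteq> 0 \<longrightarrow> J (c *\<^sub>R u) = ereal (\<bar>c\<bar> powr p) * J u)"

definition null_space :: "('a \<Rightarrow> ereal) \<Rightarrow> 'a set" where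
  "null_space J = {u. J u = 0}"

definition subdifferential :: "('a::real_inner \<Rightarrow> ereal) \<Rightarrow> 'a \<Rightarrow> 'a set" where
  "subdifferential J u = {\<zeta>. \<forall>v. J v \<ge> J u + ereal (\<zeta> \<bullet> (v - u))}"

definition admissible_set :: "('a::real_inner \<Rightarrow> ereal) \<Rightarrow> 'a set" where
  "admissible_set J = orthogonal_comp (null_space J) - {0}"

definition rayleigh_quotient :: "real \<Rightarrow> ('a::real_inner \<Rightarrow> ereal) \<Rightarrow> 'a \<Rightarrow> ereal" where
  "rayleigh_quotient p J v = ereal p * J v / ereal (norm v powr p)"

definition lambda1 :: "real \<Rightarrow> ('a::real_inner \<Rightarrow> ereal) \<Rightarrow> ereal" where
  "lambda1 p J = (INF v \<in> admissible_set J. rayleigh_quotient p J v)"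

text \<open>
  As usual in convex analysis, a point at which the objective is \<open>+\<infinity>\<close> is not a minimiser
  (it would be one, vacuously, when the objective is identically \<open>+\<infinity>\<close> on the feasible set).
\<close>

definition minimiser_on :: "'a set \<Rightarrow> ('a \<Rightarrow> ereal) \<Rightarrow> 'a \<Rightarrow> bool" where
  "minimiser_on S f u \<longleftrightarrow> u \<in> S \<and> f u < \<infinity> \<and> (\<forall>v\<in>S. f u \<le> f v)"

end

theory Submission
  imports Defs
begin

text \<open>
  Write \<open>N\<close> for the null space and \<open>\<lambda>\<close> for the infimum of the Rayleigh quotient. Two facts drive
  the equivalence.

  For a minimiser \<open>u\<close>, the bound \<open>J w \<ge> (\<lambda>/p) \<parallel>w\<parallel>\<^sup>p\<close> holds on \<open>N\<^sup>\<bottom>\<close>, with equality at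
  \<open>u\<close>. Convexity and evenness force \<open>J \<ge> 0\<close>, hence \<open>\<lambda> \<ge> 0\<close>, and Young's inequality
  says that \<open>(\<lambda>/p) \<parallel>w\<parallel>\<^sup>p\<close> lies above its tangent plane at \<open>u\<close>, whose slope is \<open>\<lambda> \<parallel>u\<parallel>\<^sup>p\<^sup>-\<^sup>2 u\<close>;
  so \<open>J\<close> lies above that plane on \<open>N\<^sup>\<bottom>\<close>. The bound extends to the whole space because \<open>N\<close> is a closed subspace: every \<open>v\<close> splits as \<open>n + w\<close> with \<open>n \<in> N\<close> and
  \<open>w \<in> N\<^sup>\<bottom>\<close> (\<open>orthogonal_comp_decomposition\<close>), the affine minorant sees only \<open>w\<close>, and so does \<open>J\<close>
  (\<open>value_add_null_space\<close>).

  Conversely, comparing \<open>J (c u) = c\<^sup>p J u\<close> with its affine minorant along the ray through \<open>u\<close>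
  yields Euler's identity \<open>p J u = \<zeta> \<bullet> u\<close> for every \<open>\<zeta> \<in> \<partial>J u\<close>
  (\<open>subdifferential_Euler_identity\<close>). For \<open>\<zeta> = \<lambda> \<parallel>u\<parallel>\<^sup>p\<^sup>-\<^sup>2 u\<close> it reads \<open>p J u = \<lambda> \<parallel>u\<parallel>\<^sup>p\<close>, so the
  infimum \<open>\<lambda>\<close> is attained at \<open>u\<close>.
\<close>

section \<open>Orthogonal projection and Young's inequality\<close>

text \<open>
  By the parallelogram law a minimising sequence for the distance from \<open>v\<close> to \<open>N\<close> is Cauchy, since
  midpoints stay in \<open>N\<close>; its limit is a closest point, and the error at a closest point is
  orthogonal to \<open>N\<close>.
\<close>

lemma orthogonal_comp_decomposition:
  fixes N :: "'a::{real_inner, complete_space} set"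
  assumes sub: "subspace N" and cl: "closed N"
  obtains n w where "n \<in> N" "w \<in> orthogonal_comp N" "v = n + w"
proof -
  define d where "d = (INF n\<in>N. (norm (v - n))\<^sup>2)"
  have bdd: "bdd_below ((\<lambda>n. (norm (v - n))\<^sup>2) ` N)"
    by (rule bdd_belowI[of _ 0]) auto
  have ne: "N \<noteq> {}"
    using subspace_0[OF sub] by auto
  have d_le: "d \<le> (norm (v - n))\<^sup>2" if "n \<in> N" for n
    unfolding d_def using bdd that by (rule cINF_lower)
  have "\<exists>n\<in>N. (norm (v - n))\<^sup>2 < d + 1 / real (Suc k)" for k
  proof -
    have "(INF n\<in>N. (norm (v - n))\<^sup>2) < d + 1 / real (Suc k)"
      unfolding d_def[symmetric] by simp
    then show ?thesis
      using cINF_less_iff[OF ne bdd] by blast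
  qed
  then obtain x where xN: "\<And>k. x k \<in> N"
    and x_less: "\<And>k. (norm (v - x k))\<^sup>2 < d + 1 / real (Suc k)"
    by metis
  have close: "(norm (x k - x m))\<^sup>2 \<le> 2 / real (Suc k) + 2 / real (Suc m)" for k m
  proof -
    let ?mid = "(1/2) *\<^sub>R (x k + x m)"
    have "?mid \<in> N"
      using sub xN by (simp add: subspace_add subspace_scale)
    then have "d \<le> (norm (v - ?mid))\<^sup>2"
      by (rule d_le)
    moreover have "(norm (x k - x m))\<^sup>2 =
        2 * (norm (v - x k))\<^sup>2 + 2 * (norm (v - x m))\<^sup>2 - 4 * (norm (v - ?mid))\<^sup>2"
      unfolding power2_norm_eq_inner
      by (simp add: inner_diff_left inner_diff_right inner_add_left inner_add_right
          inner_commute field_simps)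
    ultimately show ?thesis
      using x_less[of k] x_less[of m] by linarith
  qed
  have "Cauchy x"
  proof (rule metric_CauchyI)
    fix e :: real
    assume e: "0 < e"
    then obtain M where M: "inverse (real (Suc M)) < e\<^sup>2 / 4"
      using reals_Archimedean[of "e\<^sup>2 / 4"] by auto
    have "dist (x m) (x n) < e" if "m \<ge> M" "n \<ge> M" for m n
    proof -
      have "1 / real (Suc k) < e\<^sup>2 / 4" if "k \<ge> M" for k
      proof -
        have "1 / real (Suc k) \<le> inverse (real (Suc M))"
          using that by (simp add: field_simps)
        then show ?thesis
          using M by simp
      qed
      from this[OF that(1)] this[OF that(2)] have "(norm (x m - x n))\<^sup>2 < e\<^sup>2"
        using close[of m n] by simp
      then show ?thesis
        using e power_less_imp_less_base[of _ 2 e] by (simp add: dist_norm)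
    qed
    then show "\<exists>M. \<forall>m\<ge>M. \<forall>n\<ge>M. dist (x m) (x n) < e"
      by blast
  qed
  then obtain n where lim: "x \<longlonglongrightarrow> n"
    using Cauchy_convergent_iff convergent_def by blast
  have nN: "n \<in> N"
    using cl xN lim closed_sequential_limits by blast
  have "(norm (v - n))\<^sup>2 \<le> d"
  proof (rule LIMSEQ_le)
    show "(\<lambda>k. (norm (v - x k))\<^sup>2) \<longlonglongrightarrow> (norm (v - n))\<^sup>2"
      by (intro tendsto_intros lim)
    show "(\<lambda>k. d + 1 / real (Suc k)) \<longlonglongrightarrow> d"
      using tendsto_add[OF tendsto_const LIMSEQ_inverse_real_of_nat, of d]
      by (simp add: inverse_eq_divide)
    show "\<exists>K. \<forall>k\<ge>K. (norm (v - x k))\<^sup>2 \<le> d + 1 / real (Suc k)"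
      using x_less less_imp_le by blast
  qed
  then have closest: "\<forall>z\<in>N. dist v n \<le> dist v z"
    using d_le by (metis dist_norm norm_ge_zero order_trans power2_le_imp_le)
  have "(v - n) \<bullet> y = 0" if "y \<in> N" for y
  proof -
    have le: "(v - n) \<bullet> z \<le> 0" if "z \<in> N" for z
      using any_closest_point_dot[OF subspace_imp_convex[OF sub] cl nN _ closest, of "n + z"]
        subspace_add[OF sub nN that] by simp
    show ?thesis
      using le[OF that] le[OF subspace_neg[OF sub that]] by simp
  qed
  then have "v - n \<in> orthogonal_comp N"
    by (simp add: orthogonal_comp_def orthogonal_def inner_commute)
  with nN that show thesis
    by (metis add.commute diff_add_cancel)
qed

text \<open>
  The conjugate exponent of \<open>p\<close> is eliminated, so that \<open>p = 1\<close> is covered: this is the tangent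
  inequality for the power \<open>p\<close> at \<open>b\<close>.
\<close>

lemma Young_powr_tangent:
  fixes a b p :: real
  assumes "p \<ge> 1" "a \<ge> 0" "b > 0"
  shows "a * b powr (p - 1) \<le> a powr p / p + (1 - 1 / p) * b powr p"
proof (cases "a = 0")
  case True
  then show ?thesis
    using assms by simp
next
  case False
  then have "(a powr p) powr (1 / p) * (b powr p) powr (1 - 1 / p)
      \<le> 1 / p * a powr p + (1 - 1 / p) * b powr p"
    using assms by (intro Youngs_inequality_0) auto
  moreover have "p * (1 - 1 / p) = p - 1"
    using assms by (simp add: field_simps)
  ultimately show ?thesis
    using assms False by (simp add: powr_powr)
qed

section \<open>The null space of a homogeneous convex functional\<close>

lemma convex_functionalD:
  assumes "convex_functional J" "s \<ge> 0" "t \<ge> 0" "s + t = 1"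
  shows "J (s *\<^sub>R x + t *\<^sub>R y) \<le> ereal s * J x + ereal t * J y"
  using assms by (simp add: convex_functional_def)

text \<open>Homogeneity makes \<open>J\<close> even, and \<open>0\<close> is the midpoint of \<open>u\<close> and \<open>-u\<close>.\<close>

lemma homogeneous_convex_nonneg:
  fixes J :: "'a::real_vector \<Rightarrow> ereal"
  assumes hom: "absolutely_homogeneous p J" and conv: "convex_functional J"
  shows "0 \<le> J u"
proof -
  have "J (-1 *\<^sub>R u) = ereal (\<bar>-1\<bar> powr p) * J u"
    using hom unfolding absolutely_homogeneous_def by (metis neg_equal_0_iff_equal zero_neq_one)
  then have even: "J (- u) = J u"
    by (simp add: one_ereal_def[symmetric])
  have "J ((1/2) *\<^sub>R u + (1/2) *\<^sub>R (- u)) \<le> ereal (1/2) * J u + ereal (1/2) * J (- u)"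
    by (rule convex_functionalD[OF conv]) auto
  moreover have "J 0 = 0"
    using hom by (simp add: absolutely_homogeneous_def)
  ultimately show ?thesis
    by (cases "J u") (auto simp: even)
qed

lemma scaleR_null_space:
  assumes "absolutely_homogeneous p J" "n \<in> null_space J"
  shows "c *\<^sub>R n \<in> null_space J"
  using assms by (cases "c = 0") (auto simp: absolutely_homogeneous_def null_space_def)

lemma subspace_null_space:
  assumes hom: "absolutely_homogeneous p J" and conv: "convex_functional J"
  shows "subspace (null_space J)"
  unfolding subspace_def
proof (intro conjI ballI allI)
  show "0 \<in> null_space J"
    using hom by (simp add: absolutely_homogeneous_def null_space_def)
next
  fix x y assume xy: "x \<in> null_space J" "y \<in> null_space J"
  have null: "J (2 *\<^sub>R x) = 0" "J (2 *\<^sub>R y) = 0"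
    using scaleR_null_space[OF hom] xy by (auto simp: null_space_def)
  have "J ((1/2) *\<^sub>R (2 *\<^sub>R x) + (1/2) *\<^sub>R (2 *\<^sub>R y))
      \<le> ereal (1/2) * J (2 *\<^sub>R x) + ereal (1/2) * J (2 *\<^sub>R y)"
    by (rule convex_functionalD[OF conv]) auto
  then have "J (x + y) \<le> 0"
    by (simp add: null)
  then show "x + y \<in> null_space J"
    using homogeneous_convex_nonneg[OF hom conv, of "x + y"] by (simp add: null_space_def)
qed (rule scaleR_null_space[OF hom])

text \<open>Since \<open>J \<ge> 0\<close>, the null space is the sublevel set of a lower semicontinuous function.\<close>

lemma closed_null_space:
  assumes nonneg: "\<And>x. 0 \<le> J x" and lsc: "lower_semicontinuous J"
  shows "closed (null_space J)"
  unfolding closed_limpt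
proof (intro allI impI)
  fix x assume lim: "x islimpt null_space J"
  show "x \<in> null_space J"
  proof (rule ccontr)
    assume "x \<notin> null_space J"
    then have "0 < J x"
      using nonneg[of x] by (auto simp: null_space_def order_less_le)
    moreover have "J x \<le> Liminf (at x) J"
      using lsc by (simp add: lower_semicontinuous_def)
    ultimately have "eventually (\<lambda>y. 0 < J y) (at x)"
      unfolding le_Liminf_iff by blast
    then have "eventually (\<lambda>y. y \<notin> null_space J) (at x)"
      by (rule eventually_mono) (simp add: null_space_def)
    with lim show False
      by (simp add: islimpt_iff_eventually)
  qed
qed

text \<open>
  Writing \<open>w + n\<close> as the convex combination of \<open>w / (1 - t)\<close> and \<open>n / t\<close> gives
  \<open>J (w + n) \<le> (1 - t)\<^sup>1\<^sup>-\<^sup>p J w\<close>, and the factor tends to \<open>1\<close> as \<open>t\<close> decreases to \<open>0\<close>.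
\<close>

lemma value_add_null_space_le:
  assumes hom: "absolutely_homogeneous p J" and conv: "convex_functional J"
    and n: "n \<in> null_space J"
  shows "J (w + n) \<le> J w"
proof (cases "J w")
  case (real r)
  have bound: "J (w + n) \<le> ereal ((1 - t) * (1 / (1 - t)) powr p * r)" if t: "0 < t" "t < 1" for t
  proof -
    have "J ((1 - t) *\<^sub>R ((1 / (1 - t)) *\<^sub>R w) + t *\<^sub>R ((1 / t) *\<^sub>R n))
        \<le> ereal (1 - t) * J ((1 / (1 - t)) *\<^sub>R w) + ereal t * J ((1 / t) *\<^sub>R n)"
      using t by (intro convex_functionalD[OF conv]) auto
    moreover have "J ((1 / t) *\<^sub>R n) = 0"
      using scaleR_null_space[OF hom n] by (simp add: null_space_def)
    moreover have "J ((1 / (1 - t)) *\<^sub>R w) = ereal ((1 / (1 - t)) powr p) * J w"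
      using hom t unfolding absolutely_homogeneous_def by auto
    ultimately show ?thesis
      using t real by (simp add: mult.assoc)
  qed
  have "((\<lambda>t. ereal ((1 - t) * (1 / (1 - t)) powr p * r))
      \<longlongrightarrow> ereal ((1 - 0) * (1 / (1 - 0)) powr p * r)) (at_right (0::real))"
    by (intro tendsto_intros) auto
  moreover have "eventually (\<lambda>t. J (w + n) \<le> ereal ((1 - t) * (1 / (1 - t)) powr p * r))
      (at_right (0::real))"
    using eventually_at_right_real[of 0 "1::real"] by (rule eventually_mono) (use bound in auto)
  ultimately have "J (w + n) \<le> ereal ((1 - 0) * (1 / (1 - 0)) powr p * r)"
    by (rule tendsto_lowerbound) simp
  then show ?thesis
    by (simp add: real)
next
  case MInf
  then show ?thesis
    using homogeneous_convex_nonneg[OF hom conv, of w] by simp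
qed simp

lemma value_add_null_space:
  assumes hom: "absolutely_homogeneous p J" and conv: "convex_functional J"
    and n: "n \<in> null_space J"
  shows "J (w + n) = J w"
proof (rule antisym)
  have "- n \<in> null_space J"
    using scaleR_null_space[OF hom n, of "-1"] by simp
  then show "J w \<le> J (w + n)"
    using value_add_null_space_le[OF hom conv, of "- n" "w + n"] by simp
qed (rule value_add_null_space_le[OF assms])

section \<open>Subgradients and the Rayleigh quotient\<close>

text \<open>Testing the subgradient inequality at \<open>0\<close> bounds \<open>J u\<close> by \<open>\<zeta> \<bullet> u\<close>.\<close>

lemma subdifferential_imp_finite:
  assumes hom: "absolutely_homogeneous p J" and nonneg: "0 \<le> J u"
    and sg: "\<zeta> \<in> subdifferential J u"
  obtains j where "J u = ereal j"
proof -
  have "J u + ereal (\<zeta> \<bullet> (0 - u)) \<le> J 0"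
    using sg unfolding subdifferential_def by blast
  moreover have "J 0 = 0"
    using hom by (simp add: absolutely_homogeneous_def)
  ultimately have "J u + ereal (\<zeta> \<bullet> (0 - u)) \<le> 0"
    by simp
  then show thesis
    using nonneg that by (cases "J u") (simp_all only: zero_ereal_def, auto)
qed

text \<open>
  The function \<open>c\<^sup>p J u - J u - (c - 1) (\<zeta> \<bullet> u)\<close> of \<open>c > 0\<close> is nonnegative and vanishes at
  \<open>c = 1\<close>, so its derivative there is zero.
\<close>

lemma subdifferential_Euler_identity:
  fixes J :: "'a::real_inner \<Rightarrow> ereal"
  assumes hom: "absolutely_homogeneous p J" and sg: "\<zeta> \<in> subdifferential J u"
    and j: "J u = ereal j"
  shows "p * j = \<zeta> \<bullet> u"
proof -
  define g where "g c = c powr p * j - j - (c - 1) * (\<zeta> \<bullet> u)" for c :: real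
  have "DERIV g 1 :> p * 1 powr (p - 1) * j - \<zeta> \<bullet> u"
    unfolding g_def by (auto intro!: derivative_eq_intros)
  moreover have "g 1 \<le> g c" if "\<bar>1 - c\<bar> < 1" for c
  proof -
    have "c > 0"
      using that by linarith
    then have "J (c *\<^sub>R u) = ereal (c powr p * j)"
      using hom j unfolding absolutely_homogeneous_def by auto
    moreover have "J u + ereal (\<zeta> \<bullet> (c *\<^sub>R u - u)) \<le> J (c *\<^sub>R u)"
      using sg by (simp add: subdifferential_def)
    ultimately show ?thesis
      by (simp add: g_def j inner_diff_right algebra_simps)
  qed
  ultimately have "p * 1 powr (p - 1) * j - \<zeta> \<bullet> u = 0"
    using DERIV_local_min[of g _ 1 1] zero_less_one by blast
  then show ?thesis
    by simp
qed

lemma rayleigh_quotient_ge_iff: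
  fixes J :: "'a::real_inner \<Rightarrow> ereal"
  assumes "p \<ge> 1" "v \<noteq> 0"
  shows "ereal l \<le> rayleigh_quotient p J v \<longleftrightarrow> ereal (l / p * norm v powr p) \<le> J v"
proof -
  have "norm v powr p > 0"
    using assms by simp
  then show ?thesis
    using assms unfolding rayleigh_quotient_def
    by (cases "J v") (auto simp: field_simps)
qed

lemma rayleigh_quotient_eq_iff:
  fixes J :: "'a::real_inner \<Rightarrow> ereal"
  assumes "p \<ge> 1" "v \<noteq> 0"
  shows "rayleigh_quotient p J v = ereal l \<longleftrightarrow> J v = ereal (l / p * norm v powr p)"
proof -
  have "norm v powr p > 0"
    using assms by simp
  then show ?thesis
    using assms unfolding rayleigh_quotient_def
    by (cases "J v") (auto simp: field_simps)
qed

lemma minimiser_on_imp_INF_eq: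
  assumes "minimiser_on S f u"
  shows "(INF v\<in>S. f v) = f u"
  using assms unfolding minimiser_on_def by (intro INF_eqI) auto

text \<open>
  The Cauchy-Schwarz and Young inequalities put \<open>(l/p) \<parallel>w\<parallel>\<^sup>p\<close> above its tangent plane at \<open>u\<close>,
  which touches \<open>J\<close> there. Adding a null vector to \<open>w\<close> changes neither \<open>J\<close> nor the plane, whose
  slope is a multiple of \<open>u\<close>, so the comparison on the complement suffices.
\<close>

lemma growth_bound_imp_subgradient:
  fixes J :: "'a::{real_inner, complete_space} \<Rightarrow> ereal"
  assumes p: "p \<ge> 1" and hom: "absolutely_homogeneous p J" and conv: "convex_functional J"
    and lsc: "lower_semicontinuous J"
    and u: "u \<in> orthogonal_comp (null_space J)" "u \<noteq> 0" and l: "l \<ge> 0"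
    and Ju: "J u = ereal (l / p * norm u powr p)"
    and growth: "\<And>w. w \<in> orthogonal_comp (null_space J) \<Longrightarrow> ereal (l / p * norm w powr p) \<le> J w"
  shows "(l * norm u powr (p - 2)) *\<^sub>R u \<in> subdifferential J u"
  unfolding subdifferential_def
proof (intro CollectI allI)
  fix v
  let ?\<zeta> = "(l * norm u powr (p - 2)) *\<^sub>R u"
  obtain n w where n: "n \<in> null_space J" and w: "w \<in> orthogonal_comp (null_space J)"
    and v: "v = n + w"
    using orthogonal_comp_decomposition[OF subspace_null_space[OF hom conv]
        closed_null_space[OF homogeneous_convex_nonneg[OF hom conv] lsc]] by blast
  have "u \<bullet> n = 0"
    using u n by (auto simp: orthogonal_comp_def orthogonal_def inner_commute)
  have powers: "norm u powr (p - 2) * norm u = norm u powr (p - 1)"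
    "norm u powr (p - 2) * (u \<bullet> u) = norm u powr p"
    using u powr_add[of "norm u" "p - 2" 1] powr_add[of "norm u" "p - 2" 2]
    by (auto simp: power2_norm_eq_inner[symmetric] powr_numeral)
  have "norm u powr (p - 2) * (u \<bullet> w) \<le> norm u powr (p - 2) * (norm u * norm w)"
    using norm_cauchy_schwarz by (intro mult_left_mono) auto
  also have "\<dots> = norm w * norm u powr (p - 1)"
    by (simp add: powers(1)[symmetric] mult_ac)
  also have "\<dots> \<le> norm w powr p / p + (1 - 1 / p) * norm u powr p"
    using Young_powr_tangent p u by simp
  finally have tangent: "l * (norm u powr (p - 2) * (u \<bullet> w))
      \<le> l * (norm w powr p / p + (1 - 1 / p) * norm u powr p)"
    using l by (rule mult_left_mono)
  have "?\<zeta> \<bullet> (v - u) = l * (norm u powr (p - 2) * (u \<bullet> w)) - l * (norm u powr (p - 2) * (u \<bullet> u))"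
    using \<open>u \<bullet> n = 0\<close> by (simp add: v inner_diff_right inner_add_right algebra_simps)
  then have "?\<zeta> \<bullet> (v - u) = l * (norm u powr (p - 2) * (u \<bullet> w)) - l * norm u powr p"
    by (simp only: powers(2))
  with tangent have "l / p * norm u powr p + ?\<zeta> \<bullet> (v - u) \<le> l / p * norm w powr p"
    by (simp add: algebra_simps)
  then have "J u + ereal (?\<zeta> \<bullet> (v - u)) \<le> ereal (l / p * norm w powr p)"
    by (simp add: Ju)
  also have "\<dots> \<le> J w"
    using w by (rule growth)
  also have "\<dots> = J v"
    using value_add_null_space[OF hom conv n, of w] by (simp add: v add.commute)
  finally show "J u + ereal (?\<zeta> \<bullet> (v - u)) \<le> J v" .
qed

theorem theorem2p30:
  fixes J :: "'a::{real_inner, complete_space} \<Rightarrow> ereal" and p :: real and u :: 'a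
  assumes "p \<ge> 1"
    and "absolutely_homogeneous p J"
    and "convex_functional J"
    and "proper_functional J"
    and "lower_semicontinuous J"
    and "u \<in> orthogonal_comp (null_space J) - {0}"
  shows "(minimiser_on (admissible_set J) (rayleigh_quotient p J) u \<longleftrightarrow>
           (\<exists>l::real. lambda1 p J = ereal l \<and>
              (l * norm u powr (p - 2)) *\<^sub>R u \<in> subdifferential J u))
       \<and> (minimiser_on (admissible_set J) (rayleigh_quotient p J) u \<longrightarrow>
           lambda1 p J = ereal p * J u / ereal (norm u powr p))"
proof -
  note p = assms(1) and hom = assms(2) and conv = assms(3) and lsc = assms(5)
  have nonneg: "0 \<le> J x" for x
    by (rule homogeneous_convex_nonneg[OF hom conv])
  have u: "u \<in> orthogonal_comp (null_space J)" "u \<noteq> 0"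
    using assms(6) by auto
  have INF: "lambda1 p J = rayleigh_quotient p J u"
    if "minimiser_on (admissible_set J) (rayleigh_quotient p J) u"
    unfolding lambda1_def using that by (rule minimiser_on_imp_INF_eq)
  have "\<exists>l. lambda1 p J = ereal l \<and> (l * norm u powr (p - 2)) *\<^sub>R u \<in> subdifferential J u"
    if min: "minimiser_on (admissible_set J) (rayleigh_quotient p J) u"
  proof -
    have ge0: "ereal 0 \<le> rayleigh_quotient p J u"
      unfolding rayleigh_quotient_ge_iff[OF p u(2)] using nonneg[of u]
      by (simp add: zero_ereal_def)
    then obtain l where l: "rayleigh_quotient p J u = ereal l"
      using min by (cases "rayleigh_quotient p J u") (auto simp: minimiser_on_def)
    have "ereal (l / p * norm w powr p) \<le> J w" if "w \<in> orthogonal_comp (null_space J)" for w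
    proof (cases "w = 0")
      case False
      with that have "ereal l \<le> rayleigh_quotient p J w"
        using min l by (auto simp: minimiser_on_def admissible_set_def)
      then show ?thesis
        using rayleigh_quotient_ge_iff[OF p False] by simp
    qed (use nonneg in \<open>simp add: zero_ereal_def\<close>)
    then have "(l * norm u powr (p - 2)) *\<^sub>R u \<in> subdifferential J u"
      using growth_bound_imp_subgradient[OF p hom conv lsc u] ge0
        l rayleigh_quotient_eq_iff[OF p u(2)] by simp
    with INF[OF min] l show ?thesis
      by auto
  qed
  moreover have "minimiser_on (admissible_set J) (rayleigh_quotient p J) u"
    if l: "lambda1 p J = ereal l"
      and sg: "(l * norm u powr (p - 2)) *\<^sub>R u \<in> subdifferential J u" for l
  proof -
    obtain j where j: "J u = ereal j"
      using subdifferential_imp_finite[OF hom nonneg sg] .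
    have "norm u powr (p - 2) * (u \<bullet> u) = norm u powr p"
      using u powr_add[of "norm u" "p - 2" 2]
      by (auto simp: power2_norm_eq_inner[symmetric] powr_numeral)
    then have "p * j = l * norm u powr p"
      using subdifferential_Euler_identity[OF hom sg j] by simp
    then have "rayleigh_quotient p J u = ereal l"
      using p unfolding rayleigh_quotient_eq_iff[OF p u(2)] by (simp add: j field_simps)
    moreover have "lambda1 p J \<le> rayleigh_quotient p J v" if "v \<in> admissible_set J" for v
      unfolding lambda1_def using that by (rule INF_lower)
    ultimately show ?thesis
      using l assms(6) by (auto simp: minimiser_on_def admissible_set_def)
  qed
  ultimately show ?thesis
    using INF unfolding rayleigh_quotient_def by blast
qed

end
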